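(* Let $N\ge2$ and let $\Omega\subset\mathbb R^N$ be a bounded domain such that $0\in\Omega$. Let $q>1$, $0\le\tau<1$, $\rho,\lambda\in\mathbb R$ and $\theta\le-2$. Then the equation $$\Delta u-(N-2+2\rho)\frac{x\cdot\nabla u}{|x|^2}+\lambda\,\frac{u^\tau|\nabla u|^{1-\tau}}{|x|^{1+\tau}}=|x|^\theta u^q\quad\text{in }\Omega\setminus\{0\},$$ subject to $u=0$ on $\partial\Omega$, has no positive $C^2(\Omega\setminus\{0\})\cap C(\overline\Omega\setminus\{0\})$-solutions.
   Context: For $\tau=0$, the term $\lambda\,u^\tau|\nabla u|^{1-\tau}/|x|^{1+\tau}$ is $\lambda|\nabla u|/|x|$. Positive means $u>0$ in $\Omega\setminus\{0\}$. *)

theory Defs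
  imports "HOL-Analysis.Analysis"
begin

definition partial :: "'n::finite \<Rightarrow> (real^'n \<Rightarrow> real) \<Rightarrow> real^'n \<Rightarrow> real"
  where "partial i f x = frechet_derivative f (at x) (axis i 1)"

definition gradient :: "(real^'n::finite \<Rightarrow> real) \<Rightarrow> real^'n \<Rightarrow> real^'n"
  where "gradient f x = (\<chi> i. partial i f x)"

definition laplacian :: "(real^'n::finite \<Rightarrow> real) \<Rightarrow> real^'n \<Rightarrow> real"
  where "laplacian f x = (\<Sum>i\<in>UNIV. partial i (partial i f) x)"

(* C1_on and C2_on are meant for open S: derivatives are taken in the full space, at x. *)

definition C1_on :: "(real^'n::finite) set \<Rightarrow> (real^'n \<Rightarrow> real) \<Rightarrow> bool"
  where "C1_on S f \<longleftrightarrow>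
    (\<forall>x\<in>S. f differentiable (at x)) \<and> (\<forall>i. continuous_on S (partial i f))"

definition C2_on :: "(real^'n::finite) set \<Rightarrow> (real^'n \<Rightarrow> real) \<Rightarrow> bool"
  where "C2_on S f \<longleftrightarrow> C1_on S f \<and> (\<forall>i. C1_on S (partial i f))"

end

(* In the variable t = ln |x| a radial function W(t) turns the equation into the ODE
   W'' - 2 rho W' + lam W^tau |W'|^(1 - tau) = |x|^(theta + 2) W^q, and |x|^(theta + 2) is bounded
   below on the bounded domain because theta <= -2. For a = 2/(q - 1), b = (1 - tau)/(q - 1) and A large,
   W(s) = A (s^(-a) + s^(-b)) is a supersolution on the whole of s > 0: the first power absorbs
   the terms near s = 0, the second one those at infinity. Put s = ln |x| + T, so that W blows up on
   the sphere |x| = exp(-T). If max u/W = k > 1, then k W touches u from above; the left-hand side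
   is homogeneous of degree 1 while k^q > k, a contradiction. (Comparing the quotient rather
   than the difference is what makes the gradient term harmless for either sign of lam.) Hence
   u <= W, and T -> infinity gives u <= 0. *)

theory Submission
  imports Defs
begin

section \<open>Derivative tests at a point where a radial function touches from above\<close>

lemma local_max_second_deriv_nonpos:
  fixes f g :: "real \<Rightarrow> real"
  assumes f: "\<forall>\<^sub>F r in at 0. (f has_real_derivative g r) (at r)"
    and f0: "(f has_real_derivative g 0) (at 0)"
    and g: "(g has_real_derivative D) (at 0)"
    and max: "\<forall>\<^sub>F r in at 0. f r \<le> f 0"
  shows "g 0 = 0" and "D \<le> 0"
proof -
  obtain d1 where d1: "d1 > 0" "\<And>r. r \<noteq> 0 \<Longrightarrow> \<bar>r\<bar> < d1 \<Longrightarrow> (f has_real_derivative g r) (at r)"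
    using f by (auto simp: eventually_at)
  obtain d2 where d2: "d2 > 0" "\<And>r. r \<noteq> 0 \<Longrightarrow> \<bar>r\<bar> < d2 \<Longrightarrow> f r \<le> f 0"
    using max by (auto simp: eventually_at)
  show g0: "g 0 = 0"
    by (rule DERIV_local_max[OF f0 d2(1)]) (metis abs_minus_commute d2(2) diff_zero order_refl)
  show "D \<le> 0"
  proof (rule ccontr)
    assume "\<not> D \<le> 0"
    \<comment> \<open>As \<open>g 0 = 0\<close>, a positive \<open>D\<close> makes \<open>g\<close>
      positive just to the right of 0. By the mean value theorem \<open>f\<close> then exceeds
      \<open>f 0\<close> at points arbitrarily close to 0.\<close>
    then obtain d3 where d3: "d3 > 0" "\<And>h. 0 < h \<Longrightarrow> h < d3 \<Longrightarrow> g 0 < g (0 + h)"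
      using DERIV_pos_inc_right[OF g] by (metis not_le)
    define r where "r = min d1 (min d2 d3) / 2"
    have r: "r > 0" "r < d1" "r < d2" "r < d3" using d1 d2 d3 by (auto simp: r_def)
    have "\<And>x. 0 \<le> x \<Longrightarrow> x \<le> r \<Longrightarrow> (f has_real_derivative g x) (at x)"
      using d1(2) f0 r by (metis abs_of_nonneg order_le_less_trans)
    then obtain z where z: "0 < z" "z < r" "f r - f 0 = (r - 0) * g z"
      using MVT2[OF r(1)] by blast
    have "g z > 0" using d3(2)[of z] z r g0 by simp
    then have "f r > f 0" using z(3) r(1) by (smt (verit) mult_pos_pos)
    with d2(2)[of r] r show False by simp
  qed
qed

lemma C1_on_subset: "C1_on S f \<Longrightarrow> T \<subseteq> S \<Longrightarrow> C1_on T f"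
  unfolding C1_on_def by (auto intro: continuous_on_subset[of S])

lemma C2_on_subset: "C2_on S f \<Longrightarrow> T \<subseteq> S \<Longrightarrow> C2_on T f"
  unfolding C2_on_def by (auto intro: C1_on_subset[of S])

lemma has_real_derivative_along_axis:
  fixes f :: "real^'n::finite \<Rightarrow> real"
  assumes "f differentiable (at (x + r *\<^sub>R axis i 1))"
  shows "((\<lambda>r. f (x + r *\<^sub>R axis i 1)) has_real_derivative partial i f (x + r *\<^sub>R axis i 1)) (at r)"
proof -
  let ?D = "frechet_derivative f (at (x + r *\<^sub>R axis i 1))"
  have D: "(f has_derivative ?D) (at (x + r *\<^sub>R axis i 1))"
    using assms frechet_derivative_works by blast
  have "((\<lambda>r. x + r *\<^sub>R axis i 1) has_derivative (\<lambda>h. h *\<^sub>R axis i 1)) (at r)"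
    by (auto intro!: derivative_eq_intros)
  from diff_chain_at[OF this D]
  have "((\<lambda>r. f (x + r *\<^sub>R axis i 1)) has_derivative (\<lambda>h. ?D (h *\<^sub>R axis i 1))) (at r)"
    by (simp add: o_def)
  moreover have "?D (h *\<^sub>R axis i 1) = partial i f (x + r *\<^sub>R axis i 1) * h" for h
    using linear_scale[OF has_derivative_linear[OF D]] by (simp add: partial_def)
  ultimately show ?thesis
    by (simp add: has_field_derivative_def)
qed

lemma norm_add_axis_power2:
  fixes x :: "real^'n::finite"
  shows "(norm (x + r *\<^sub>R axis i 1))\<^sup>2 = (norm x)\<^sup>2 + 2 * r * x $ i + r\<^sup>2"
  unfolding power2_norm_eq_inner
  by (simp add: inner_add_left inner_add_right inner_axis inner_axis' power2_eq_square distrib_left)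

lemma has_real_derivative_ln_norm_along_axis:
  fixes x :: "real^'n::finite"
  assumes "x + r *\<^sub>R axis i 1 \<noteq> 0"
  shows "((\<lambda>r. ln (norm (x + r *\<^sub>R axis i 1))) has_real_derivative
      (x $ i + r) / (norm (x + r *\<^sub>R axis i 1))\<^sup>2) (at r)"
proof -
  note sq = norm_add_axis_power2[of x _ i]
  \<comment> \<open>The squared norm is a quadratic polynomial in \<open>r\<close>, so half the
    logarithm of the square is easy to differentiate. At \<open>y = 0\<close> the identity rests on
    the convention \<open>ln 0 = 0\<close>.\<close>
  have half: "ln (norm y) = ln ((norm y)\<^sup>2) / 2" for y :: "real^'n"
    by (cases "y = 0") (simp_all add: ln_realpow)
  have pos: "(norm x)\<^sup>2 + 2 * r * x $ i + r\<^sup>2 > 0"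
    using assms unfolding sq[symmetric] by simp
  have "((\<lambda>r. ln ((norm x)\<^sup>2 + 2 * r * x $ i + r\<^sup>2) / 2) has_real_derivative
      (x $ i + r) / ((norm x)\<^sup>2 + 2 * r * x $ i + r\<^sup>2)) (at r)"
    using pos by (auto intro!: derivative_eq_intros simp: field_simps)
  then show ?thesis
    unfolding half sq .
qed

text \<open>On every line through \<open>x\<close> parallel to a coordinate axis, the difference
  between \<open>u\<close> and the radial function has a local maximum at \<open>x\<close>. The
  one-variable test thus gives equal first partial derivatives and an inequality between pure second
  ones. Summing the latter yields the Laplacian of a radial function written in t = ln |x|.\<close>

lemma radial_touching_above:
  fixes u :: "real^'n::finite \<Rightarrow> real" and F F' :: "real \<Rightarrow> real"
  assumes S: "open S" "x \<in> S" "0 \<notin> S" and u: "C2_on S u"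
    and F: "\<And>y. y \<in> S \<Longrightarrow> (F has_real_derivative F' (ln (norm y))) (at (ln (norm y)))"
    and F': "(F' has_real_derivative F'') (at (ln (norm x)))"
    and le: "\<And>y. y \<in> S \<Longrightarrow> u y \<le> F (ln (norm y))"
    and eq: "u x = F (ln (norm x))"
  shows "gradient u x = (F' (ln (norm x)) / (norm x)\<^sup>2) *\<^sub>R x"
    and "laplacian u x \<le> (F'' + (real CARD('n) - 2) * F' (ln (norm x))) / (norm x)\<^sup>2"
proof -
  let ?t = "ln (norm x)" and ?y = "(norm x)\<^sup>2"
  have x0: "x \<noteq> 0" using S by auto
  then have y0: "?y > 0" by simp
  \<comment> \<open>\<open>b i\<close> is the second derivative at \<open>x\<close> of F(ln |x|) in
    direction \<open>i\<close>: the chain rule is applied with x_i / |x|^2 and 1 / |x|^2 - 2 x_i^2 /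
    |x|^4 as the first two derivatives of ln |x|.\<close>
  define b where "b i = F'' * (x $ i / ?y)\<^sup>2 + F' ?t * (1 / ?y - 2 * (x $ i)\<^sup>2 / ?y\<^sup>2)" for i
  have *: "partial i u x = F' ?t * (x $ i) / ?y \<and> partial i (partial i u) x \<le> b i" for i
  proof -
    let ?l = "\<lambda>r. x + r *\<^sub>R axis i 1 :: real^'n"
    have "continuous_on UNIV ?l" by (intro continuous_intros)
    then have op: "open (?l -` S)" using S(1) open_vimage by blast
    have ev: "\<forall>\<^sub>F r in nhds 0. ?l r \<in> S"
      using eventually_nhds_in_open[OF op, of 0] S(2) by simp
    \<comment> \<open>\<open>g\<close> is the derivative along the axis of the difference that is
      maximal at \<open>r = 0\<close>; its own derivative there is the second partial derivative of
      \<open>u\<close> minus \<open>b i\<close>.\<close>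
    define g where "g r = partial i u (?l r) - F' (ln (norm (?l r))) * ((x $ i + r) / (norm (?l r))\<^sup>2)" for r
    have d: "((\<lambda>r. u (?l r) - F (ln (norm (?l r)))) has_real_derivative g r) (at r)" if "?l r \<in> S" for r
    proof -
      have "u differentiable (at (?l r))" "?l r \<noteq> 0"
        using u that S(3) by (auto simp: C2_on_def C1_on_def)
      then show ?thesis
        unfolding g_def
        using DERIV_diff[OF has_real_derivative_along_axis
            DERIV_chain2[OF F[OF that] has_real_derivative_ln_norm_along_axis]]
        by blast
    qed
    have n1: "((\<lambda>r. ln (norm (?l r))) has_real_derivative x $ i / ?y) (at 0)"
      using has_real_derivative_ln_norm_along_axis[of x 0 i] x0 by simp
    have "partial i u differentiable (at x)"
      using u S(2) by (auto simp: C2_on_def C1_on_def)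
    then have p: "((\<lambda>r. partial i u (?l r)) has_real_derivative partial i (partial i u) x) (at 0)"
      using has_real_derivative_along_axis[of "partial i u" x 0 i] by simp
    have c: "((\<lambda>r. F' (ln (norm (?l r)))) has_real_derivative F'' * (x $ i / ?y)) (at 0)"
      using DERIV_chain2[OF _ n1, of F' F''] F' by simp
    note sq = norm_add_axis_power2[of x _ i]
    have e: "((\<lambda>r. (x $ i + r) / (norm (?l r))\<^sup>2) has_real_derivative
        1 / ?y - 2 * (x $ i)\<^sup>2 / ?y\<^sup>2) (at 0)"
      unfolding sq using x0
      by (auto intro!: derivative_eq_intros simp: field_simps power2_eq_square)
    have gd: "(g has_real_derivative (partial i (partial i u) x - b i)) (at 0)"
      unfolding g_def
      by (rule derivative_eq_intros p c e refl)+
        (use x0 in \<open>simp add: b_def power2_eq_square algebra_simps\<close>)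
    have "\<forall>\<^sub>F r in at 0. ((\<lambda>r. u (?l r) - F (ln (norm (?l r)))) has_real_derivative g r) (at r)"
      using ev d by (auto simp: eventually_at_filter elim: eventually_mono)
    moreover have "((\<lambda>r. u (?l r) - F (ln (norm (?l r)))) has_real_derivative g 0) (at 0)"
      using d[of 0] S(2) by simp
    moreover have "\<forall>\<^sub>F r in at 0. u (?l r) - F (ln (norm (?l r))) \<le> u (?l 0) - F (ln (norm (?l 0)))"
      using ev le eq by (auto simp: eventually_at_filter elim!: eventually_mono)
    ultimately have "g 0 = 0" "partial i (partial i u) x - b i \<le> 0"
      using local_max_second_deriv_nonpos[OF _ _ gd] by blast+
    then show ?thesis by (simp add: g_def)
  qed
  show "gradient u x = (F' ?t / ?y) *\<^sub>R x"
    by (simp add: vec_eq_iff gradient_def *)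
  have s2: "(\<Sum>i\<in>UNIV. (x $ i)\<^sup>2) = ?y"
    unfolding power2_norm_eq_inner by (simp add: inner_vec_def power2_eq_square)
  have "laplacian u x \<le> (\<Sum>i\<in>UNIV. b i)"
    unfolding laplacian_def by (intro sum_mono) (simp add: *)
  \<comment> \<open>The squares of the coordinates sum to \<open>?y\<close>, while the last summand
    occurs once per dimension. This is where the coefficient N - 2 of F' arises.\<close>
  also have "(\<Sum>i\<in>UNIV. b i) = (\<Sum>i\<in>UNIV. (F'' - 2 * F' ?t) / ?y\<^sup>2 * (x $ i)\<^sup>2 + F' ?t / ?y)"
    by (intro sum.cong refl) (simp add: b_def power_divide diff_divide_distrib algebra_simps)
  also have "\<dots> = (F'' - 2 * F' ?t) / ?y\<^sup>2 * ?y + real CARD('n) * (F' ?t / ?y)"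
    by (simp only: sum.distrib sum_distrib_left[symmetric] s2) simp
  also have "\<dots> = (F'' + (real CARD('n) - 2) * F' ?t) / ?y"
  proof -
    have "(F'' - 2 * F' ?t) / ?y\<^sup>2 * ?y = (F'' - 2 * F' ?t) / ?y"
      by (simp add: power2_eq_square)
    then show ?thesis by (simp only:) (simp add: diff_divide_distrib add_divide_distrib left_diff_distrib)
  qed
  finally show "laplacian u x \<le> (F'' + (real CARD('n) - 2) * F' ?t) / ?y" .
qed

section \<open>The barrier in the logarithmic variable and its differential inequality\<close>

definition barrier :: "real \<Rightarrow> real \<Rightarrow> real \<Rightarrow> real \<Rightarrow> real"
  where "barrier A a b s = A * (s powr - a + s powr - b)"

definition barrier' :: "real \<Rightarrow> real \<Rightarrow> real \<Rightarrow> real \<Rightarrow> real"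
  where "barrier' A a b s = - A * (a * s powr (- a - 1) + b * s powr (- b - 1))"

definition barrier'' :: "real \<Rightarrow> real \<Rightarrow> real \<Rightarrow> real \<Rightarrow> real"
  where "barrier'' A a b s =
    A * (a * (a + 1) * s powr (- a - 2) + b * (b + 1) * s powr (- b - 2))"

lemma barrier_derivs:
  assumes "s > 0"
  shows "(barrier A a b has_real_derivative barrier' A a b s) (at s)"
    and "(barrier' A a b has_real_derivative barrier'' A a b s) (at s)"
proof -
  have p: "((\<lambda>s. s powr c) has_real_derivative c * s powr (c - 1)) (at s)" for c
    using has_real_derivative_powr[OF assms] by simp
  show "(barrier A a b has_real_derivative barrier' A a b s) (at s)"
    unfolding barrier_def[abs_def] barrier'_def
    by (rule derivative_eq_intros p refl)+ (simp add: algebra_simps)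
  show "(barrier' A a b has_real_derivative barrier'' A a b s) (at s)"
    unfolding barrier'_def[abs_def] barrier''_def
    by (rule derivative_eq_intros p refl)+ (simp add: algebra_simps)
qed

lemma barrier_pos: "A > 0 \<Longrightarrow> s > 0 \<Longrightarrow> barrier A a b s > 0"
  by (simp add: barrier_def add_pos_pos)

text \<open>Each derivative of a power of s costs a factor 1/s and a constant increasing in the size
  of the exponent. Since \<open>b \<le> a\<close>, the constants of the first power serve for
  both.\<close>

lemma barrier_deriv_bounds:
  assumes "A > 0" "0 < b" "b \<le> a" "s > 0"
  shows "\<bar>barrier' A a b s\<bar> \<le> a * barrier A a b s / s"
    and "barrier'' A a b s \<le> a * (a + 1) * barrier A a b s / s\<^sup>2"
proof -
  have s1: "s powr (c - 1) = s powr c / s" for c using assms by (simp add: powr_diff)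
  have s2: "s powr (c - 2) = s powr c / s\<^sup>2" for c using assms by (simp add: powr_diff)
  have "b * s powr - b \<le> a * s powr - b" using assms by (intro mult_right_mono) auto
  then have "A * (a * s powr - a + b * s powr - b) / s \<le> A * (a * s powr - a + a * s powr - b) / s"
    using assms by (intro divide_right_mono mult_left_mono) auto
  moreover have "barrier' A a b s = - (A * (a * s powr - a + b * s powr - b) / s)"
    by (simp add: barrier'_def s1 add_divide_distrib algebra_simps)
  moreover have "A * (a * s powr - a + b * s powr - b) / s \<ge> 0" using assms by auto
  ultimately show "\<bar>barrier' A a b s\<bar> \<le> a * barrier A a b s / s"
    by (simp add: barrier_def algebra_simps)
  have "b * (b + 1) * s powr - b \<le> a * (a + 1) * s powr - b"
    using assms by (intro mult_right_mono mult_mono) auto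
  then have "A * (a * (a + 1) * s powr - a + b * (b + 1) * s powr - b) / s\<^sup>2
      \<le> A * (a * (a + 1) * s powr - a + a * (a + 1) * s powr - b) / s\<^sup>2"
    using assms by (intro divide_right_mono mult_left_mono) auto
  moreover have "barrier'' A a b s
      = A * (a * (a + 1) * s powr - a + b * (b + 1) * s powr - b) / s\<^sup>2"
    unfolding barrier''_def s2 by (simp add: add_divide_distrib distrib_left)
  ultimately show "barrier'' A a b s \<le> a * (a + 1) * barrier A a b s / s\<^sup>2"
    by (simp add: barrier_def algebra_simps)
qed

text \<open>With W the barrier, every term on the left is at most a constant times W times one of
  s^(-2), s^(-1), s^(-(1 - \<tau>)). The exponents \<open>a\<close> and \<open>b\<close> are chosen
  so that W^(q - 1) dominates the first and the last of these powers, and the middle one lies below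
  their maximum.\<close>

lemma barrier_supersolution:
  fixes q \<tau> \<rho> lam c :: real
  assumes "q > 1" "0 \<le> \<tau>" "\<tau> < 1" "c > 0"
  defines "a \<equiv> 2 / (q - 1)" and "b \<equiv> (1 - \<tau>) / (q - 1)"
  obtains A where "A > 0"
    and "\<And>s. s > 0 \<Longrightarrow> barrier'' A a b s - 2 * \<rho> * barrier' A a b s
        + lam * (barrier A a b s powr \<tau> * \<bar>barrier' A a b s\<bar> powr (1 - \<tau>))
      \<le> c * barrier A a b s powr q"
proof -
  have ab: "0 < b" "b \<le> a" "0 < a"
    using assms by (auto simp: a_def b_def divide_right_mono)
  have cancel: "x / (q - 1) * (q - 1) = x" for x
    using assms(1) by simp
  have aq: "a * (q - 1) = 2" "b * (q - 1) = 1 - \<tau>"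
    unfolding a_def b_def by (rule cancel)+
  \<comment> \<open>\<open>C\<close> adds up the constants from the three terms on the left;
    \<open>A\<close> below is the solution of \<open>c * A powr (q - 1) = C\<close>.\<close>
  define C where "C = a * (a + 1) + 2 * \<bar>\<rho>\<bar> * a + \<bar>lam\<bar> * a powr (1 - \<tau>)"
  have "a * (a + 1) > 0" "2 * \<bar>\<rho>\<bar> * a \<ge> 0" "\<bar>lam\<bar> * a powr (1 - \<tau>) \<ge> 0" using ab by auto
  then have C: "C > 0" unfolding C_def by linarith
  define A where "A = (C / c) powr (1 / (q - 1))"
  have A: "A > 0" using C assms by (simp add: A_def)
  have Aq: "c * A powr (q - 1) = C" using C assms by (simp add: A_def powr_powr)
  have "barrier'' A a b s - 2 * \<rho> * barrier' A a b s
        + lam * (barrier A a b s powr \<tau> * \<bar>barrier' A a b s\<bar> powr (1 - \<tau>))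
      \<le> c * barrier A a b s powr q" if s: "s > 0" for s
  proof -
    let ?W = "barrier A a b s" and ?W1 = "barrier' A a b s"
    note W = barrier_pos[OF A s, of a b]
    \<comment> \<open>The exponent 1 lies between 1 - \<tau> and 2, so s^(-1) is below s^(-2) for s
      at most 1 and below s^(-(1 - \<tau>)) for s above 1. Hence \<open>m\<close> bounds all three
      powers.\<close>
    define m where "m = max (s powr - 2) (s powr - (1 - \<tau>))"
    have "s powr - 1 \<le> m"
    proof (cases "s \<le> 1")
      case True
      then have "s powr - 1 \<le> s powr - 2" using s by (intro powr_mono') auto
      then show ?thesis by (simp add: m_def)
    next
      case False
      then have "s powr - 1 \<le> s powr - (1 - \<tau>)" using assms by (intro powr_mono) auto
      then show ?thesis by (simp add: m_def)
    qed
    then have m: "1 / s \<le> m" "1 / s\<^sup>2 \<le> m" "s powr - (1 - \<tau>) \<le> m"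
      using s by (auto simp: m_def powr_minus field_simps)
    \<comment> \<open>The barrier is at least each of its two summands. Raised to the power q - 1,
      these become A^(q - 1) times s^(-2) and s^(-(1 - \<tau>)), by \<open>aq\<close>.\<close>
    have pw: "(A * s powr - k) powr (q - 1) \<le> ?W powr (q - 1)" if "k = a \<or> k = b" for k
      using that A assms by (intro powr_mono2) (auto simp: barrier_def)
    have "A powr (q - 1) * s powr - 2 \<le> ?W powr (q - 1)"
      using pw[of a] A s aq by (simp add: powr_mult powr_powr)
    moreover have "A powr (q - 1) * s powr - (1 - \<tau>) \<le> ?W powr (q - 1)"
      using pw[of b] A s aq by (simp add: powr_mult powr_powr)
    ultimately have mq: "A powr (q - 1) * m \<le> ?W powr (q - 1)"
      by (simp add: m_def max_def)
    note bd = barrier_deriv_bounds[OF A ab(1,2) s]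
    have "barrier'' A a b s \<le> a * (a + 1) * ?W * m"
      using bd(2) mult_left_mono[OF m(2), of "a * (a + 1) * ?W"] ab W by simp
    moreover have W1: "\<bar>?W1\<bar> \<le> a * ?W * m"
      using bd(1) mult_left_mono[OF m(1), of "a * ?W"] ab W by simp
    then have "- 2 * \<rho> * ?W1 \<le> 2 * \<bar>\<rho>\<bar> * (a * ?W * m)"
    proof -
      have "- 2 * \<rho> * ?W1 \<le> \<bar>2 * \<rho> * ?W1\<bar>" by simp
      also have "\<dots> = 2 * \<bar>\<rho>\<bar> * \<bar>?W1\<bar>" by (simp add: abs_mult)
      also have "\<dots> \<le> 2 * \<bar>\<rho>\<bar> * (a * ?W * m)" using W1 by (intro mult_left_mono) auto
      finally show ?thesis .
    qed
    \<comment> \<open>The exponents \<tau> and 1 - \<tau> add up to 1, so after inserting the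
      derivative bound exactly one factor W remains. Passing to the absolute value of
      \<open>lam\<close> covers both signs.\<close>
    moreover have "lam * (?W powr \<tau> * \<bar>?W1\<bar> powr (1 - \<tau>)) \<le> \<bar>lam\<bar> * (a powr (1 - \<tau>) * ?W * m)"
    proof -
      have "\<bar>?W1\<bar> powr (1 - \<tau>) \<le> (a * ?W / s) powr (1 - \<tau>)"
        using bd(1) assms by (intro powr_mono2) auto
      also have "\<dots> = a powr (1 - \<tau>) * ?W powr (1 - \<tau>) * s powr - (1 - \<tau>)"
        unfolding powr_minus_divide using ab W s by (simp add: powr_mult powr_divide)
      also have "\<dots> \<le> a powr (1 - \<tau>) * ?W powr (1 - \<tau>) * m"
        using m(3) by (intro mult_left_mono) auto
      finally have "?W powr \<tau> * \<bar>?W1\<bar> powr (1 - \<tau>)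
          \<le> ?W powr \<tau> * (a powr (1 - \<tau>) * ?W powr (1 - \<tau>) * m)"
        by (intro mult_left_mono) auto
      also have "\<dots> = a powr (1 - \<tau>) * (?W powr \<tau> * ?W powr (1 - \<tau>)) * m" by simp
      also have "?W powr \<tau> * ?W powr (1 - \<tau>) = ?W" using W by (simp flip: powr_add)
      finally have le: "?W powr \<tau> * \<bar>?W1\<bar> powr (1 - \<tau>) \<le> a powr (1 - \<tau>) * ?W * m" .
      have "lam * (?W powr \<tau> * \<bar>?W1\<bar> powr (1 - \<tau>)) \<le> \<bar>lam\<bar> * (?W powr \<tau> * \<bar>?W1\<bar> powr (1 - \<tau>))"
        by (intro mult_right_mono) auto
      also have "\<dots> \<le> \<bar>lam\<bar> * (a powr (1 - \<tau>) * ?W * m)"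
        using le by (intro mult_left_mono) auto
      finally show ?thesis .
    qed
    moreover have "a * (a + 1) * ?W * m + 2 * \<bar>\<rho>\<bar> * (a * ?W * m)
        + \<bar>lam\<bar> * (a powr (1 - \<tau>) * ?W * m) = C * ?W * m"
      unfolding C_def by algebra
    ultimately have "barrier'' A a b s - 2 * \<rho> * ?W1 + lam * (?W powr \<tau> * \<bar>?W1\<bar> powr (1 - \<tau>))
        \<le> C * ?W * m"
      by linarith
    also have "\<dots> = c * ?W * (A powr (q - 1) * m)" by (simp flip: Aq)
    also have "\<dots> \<le> c * ?W * ?W powr (q - 1)"
      using mq W assms by (intro mult_left_mono) auto
    also have "\<dots> = c * ?W powr q" using W by (simp add: powr_diff)
    finally show ?thesis .
  qed
  then show ?thesis by (rule that[OF A])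
qed

lemma barrier_tendsto_0:
  assumes "a > 0" "b > 0"
  shows "((\<lambda>s. barrier A a b s) \<longlongrightarrow> 0) at_top"
proof -
  have "((\<lambda>s. A * (s powr - a + s powr - b)) \<longlongrightarrow> A * (0 + 0)) at_top"
    using assms by (intro tendsto_intros tendsto_neg_powr filterlim_ident) auto
  then show ?thesis by (simp add: barrier_def)
qed

section \<open>Comparison of a solution with the shifted barrier\<close>

lemma solution_le_barrier:
  fixes u :: "real^'n::finite \<Rightarrow> real"
  assumes \<Omega>: "open \<Omega>" "bounded \<Omega>"
    and par: "q > 1" "0 \<le> \<tau>" "\<tau> < 1" "A > 0" "0 < b" "b < a"
    and c: "\<And>x. x \<in> \<Omega> - {0} \<Longrightarrow> c \<le> norm x powr (\<theta> + 2)" "c > 0"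
    and super: "\<And>s. s > 0 \<Longrightarrow> barrier'' A a b s - 2 * \<rho> * barrier' A a b s
        + lam * (barrier A a b s powr \<tau> * \<bar>barrier' A a b s\<bar> powr (1 - \<tau>))
      \<le> c * barrier A a b s powr q"
    and u: "C2_on (\<Omega> - {0}) u" "continuous_on (closure \<Omega> - {0}) u"
      "\<And>x. x \<in> frontier \<Omega> \<Longrightarrow> u x = 0"
    and eq: "\<And>x. x \<in> \<Omega> - {0} \<Longrightarrow>
         laplacian u x
         - (real CARD('n) - 2 + 2 * \<rho>) * (x \<bullet> gradient u x) / (norm x)\<^sup>2
         + lam * (u x powr \<tau> * norm (gradient u x) powr (1 - \<tau>)) / norm x powr (1 + \<tau>)
         = norm x powr \<theta> * u x powr q"
    and x1: "x1 \<in> \<Omega>" "exp (- T) < norm x1"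
  shows "u x1 \<le> barrier A a b (ln (norm x1) + T)"
proof (rule ccontr)
  let ?W = "barrier A a b"
  define s where "s x = ln (norm x) + T" for x :: "real^'n"
  assume "\<not> u x1 \<le> barrier A a b (ln (norm x1) + T)"
  then have x1W: "u x1 > ?W (s x1)" by (simp add: s_def)
  have s_pos: "s x > 0" if "exp (- T) < norm x" for x
    using ln_less_cancel_iff[of "exp (- T)" "norm x"] that
    by (smt (verit) exp_gt_zero ln_exp s_def)
  \<comment> \<open>the reciprocal of the barrier, in a form that extends continuously by 0 to s = 0\<close>
  define Q where "Q t = t powr a / (A * (1 + t powr (a - b)))" for t
  have QW: "Q t = 1 / ?W t" if "t > 0" for t
  proof -
    have "?W t * t powr a = A * (1 + t powr (a - b))"
      using that by (simp add: barrier_def algebra_simps flip: powr_add)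
    then show ?thesis
      using barrier_pos[OF par(4) that, of a b] that
      by (simp add: Q_def frac_eq_eq flip: \<open>?W t * t powr a = _\<close>)
  qed
  \<comment> \<open>\<open>K\<close> stays away from the origin, where \<open>u\<close> is not
    controlled, and includes the sphere s = 0 on which the barrier blows up. Being compact, it lets
    the quotient u/W, written with \<open>Q\<close>, attain its maximum.\<close>
  define K where "K = closure \<Omega> \<inter> {x. exp (- T) \<le> norm x}"
  have K0: "x \<noteq> 0" if "x \<in> K" for x using that by (auto simp: K_def)
  have sK: "s x \<ge> 0" if "x \<in> K" for x
    using ln_le_cancel_iff[of "exp (- T)" "norm x"] that K0[OF that]
    by (simp add: K_def s_def)
  have "closed {x :: real^'n. exp (- T) \<le> norm x}"
    by (intro closed_Collect_le continuous_intros)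
  then have "compact K"
    unfolding K_def using \<Omega> by (intro compact_Int_closed) (auto simp: compact_closure)
  moreover have "x1 \<in> K" using x1 closure_subset by (auto simp: K_def)
  moreover have "continuous_on K (\<lambda>x. u x * Q (s x))"
  proof -
    have ne: "A * (1 + t powr (a - b)) \<noteq> 0" for t
      using par by (simp add: add_nonneg_eq_0_iff)
    have "continuous_on K u"
      using K0 by (intro continuous_on_subset[OF u(2)]) (auto simp: K_def)
    moreover have "continuous_on K s"
      unfolding s_def[abs_def] using K0 by (intro continuous_intros) auto
    ultimately show ?thesis
      unfolding Q_def using par sK ne
      by (intro continuous_intros continuous_on_powr') auto
  qed
  ultimately obtain x where x: "x \<in> K" "\<And>y. y \<in> K \<Longrightarrow> u y * Q (s y) \<le> u x * Q (s x)"
    using continuous_attains_sup[of K "\<lambda>x. u x * Q (s x)"] by blast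
  define k where "k = u x * Q (s x)"
  have "1 < u x1 * Q (s x1)"
    using x1W s_pos[OF x1(2)] barrier_pos[OF par(4) s_pos[OF x1(2)], of a b] by (simp add: QW)
  then have k: "k > 1" using x(2)[OF \<open>x1 \<in> K\<close>] by (simp add: k_def)
  \<comment> \<open>A maximum above 1 cannot lie on the boundary: on the inner sphere
    \<open>Q\<close> vanishes because \<open>0 powr a = 0\<close>, and on the frontier of \<Omega>
    \<open>u\<close> vanishes. So \<open>x\<close> lies in the open set \<open>S\<close>, where the
    derivative tests apply.\<close>
  have "s x \<noteq> 0" using k par by (auto simp: k_def Q_def)
  then have sx: "s x > 0" using sK[OF x(1)] by simp
  have x\<Omega>: "x \<in> \<Omega>"
  proof (rule ccontr)
    assume "x \<notin> \<Omega>"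
    then have "u x = 0" using u(3)[of x] x(1) \<Omega> by (auto simp: K_def frontier_def interior_open)
    then show False using k by (simp add: k_def)
  qed
  define S where "S = \<Omega> \<inter> {x. exp (- T) < norm x}"
  have S: "open S" "0 \<notin> S"
    unfolding S_def using \<Omega> by (auto intro!: open_Int open_Collect_less continuous_intros)
  have "exp (- T) \<noteq> norm x" using sx K0[OF x(1)] by (metis add.commute add.right_inverse ln_exp less_irrefl s_def)
  then have xS: "x \<in> S" using x\<Omega> x(1) by (auto simp: S_def K_def)
  have SK: "S \<subseteq> K" using closure_subset by (auto simp: S_def K_def)
  have u_eq: "u x = k * ?W (s x)"
    using barrier_pos[OF par(4) sx, of a b] by (simp add: k_def QW sx)
  have u_le: "u y \<le> k * ?W (ln (norm y) + T)" if "y \<in> S" for y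
  proof -
    have sy: "s y > 0" using that s_pos by (auto simp: S_def)
    show ?thesis
      using x(2)[of y] that SK barrier_pos[OF par(4) sy, of a b]
      by (auto simp: k_def[symmetric] QW sy pos_divide_le_eq simp flip: s_def)
  qed
  have shift: "((\<lambda>t. k * f (t + T)) has_real_derivative k * d) (at t)"
    if "(f has_real_derivative d) (at (t + T))" for f d t
    using that by (intro DERIV_cmult) (simp add: DERIV_shift)
  have C2: "C2_on S u"
    using u(1) by (rule C2_on_subset) (auto simp: S_def)
  define W1 where "W1 = barrier' A a b (s x)"
  define W2 where "W2 = barrier'' A a b (s x)"
  define n where "n = norm x"
  have n: "n > 0" using K0[OF x(1)] by (simp add: n_def)
  have "((\<lambda>t. k * ?W (t + T)) has_real_derivative k * barrier' A a b (ln (norm y) + T)) (at (ln (norm y)))"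
    if "y \<in> S" for y
    using that s_pos[of y] by (intro shift barrier_derivs) (auto simp: S_def s_def)
  moreover have "((\<lambda>t. k * barrier' A a b (t + T)) has_real_derivative k * W2) (at (ln (norm x)))"
    unfolding W2_def s_def using sx by (intro shift barrier_derivs) (auto simp: s_def)
  moreover have "u x = k * ?W (ln (norm x) + T)" using u_eq by (simp add: s_def)
  ultimately have grad: "gradient u x = (k * W1 / n\<^sup>2) *\<^sub>R x"
    and lap: "laplacian u x \<le> (k * W2 + (real CARD('n) - 2) * (k * W1)) / n\<^sup>2"
    using radial_touching_above[OF S(1) xS S(2) C2, where F = "\<lambda>t. k * ?W (t + T)" and
        F' = "\<lambda>t. k * barrier' A a b (t + T)" and F'' = "k * W2"] u_le
    unfolding W1_def s_def n_def by blast+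
  note W = barrier_pos[OF par(4) sx, of a b]
  have xg: "x \<bullet> gradient u x = k * W1"
    using n by (simp add: grad n_def power2_norm_eq_inner)
  have ng: "norm (gradient u x) = k * \<bar>W1\<bar> / n"
    using n k by (simp add: grad n_def abs_mult power2_eq_square)
  \<comment> \<open>The powers of \<open>k\<close> combine to \<open>k\<close> and those of
    \<open>n\<close> to n^2. The gradient term therefore carries the same factor k / n^2 as the
    linear terms.\<close>
  have "u x powr \<tau> * norm (gradient u x) powr (1 - \<tau>) / n powr (1 + \<tau>)
      = (k powr \<tau> * k powr (1 - \<tau>)) * (?W (s x) powr \<tau> * \<bar>W1\<bar> powr (1 - \<tau>))
        / (n powr (1 - \<tau>) * n powr (1 + \<tau>))"
    using n k W by (simp add: u_eq ng powr_mult powr_divide)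
  also have "\<dots> = k * (?W (s x) powr \<tau> * \<bar>W1\<bar> powr (1 - \<tau>)) / n\<^sup>2"
    using n k by (simp flip: powr_add)
  finally have lt: "lam * (u x powr \<tau> * norm (gradient u x) powr (1 - \<tau>)) / n powr (1 + \<tau>)
      = lam * (k * (?W (s x) powr \<tau> * \<bar>W1\<bar> powr (1 - \<tau>)) / n\<^sup>2)"
    by (simp only: times_divide_eq_right[symmetric])
  \<comment> \<open>The chain starts and ends with the same expression. The terms with N - 2 cancel,
    leaving the left-hand side of \<open>super\<close> times k / n^2; strictness comes from k < k^q,
    and the lower bound \<open>c\<close> on |x|^(\<theta> + 2) closes the circle.\<close>
  have "n powr \<theta> * u x powr q
      \<le> (k * W2 + (real CARD('n) - 2) * (k * W1)) / n\<^sup>2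
        - (real CARD('n) - 2 + 2 * \<rho>) * (k * W1) / n\<^sup>2
        + lam * (k * (?W (s x) powr \<tau> * \<bar>W1\<bar> powr (1 - \<tau>)) / n\<^sup>2)"
    using eq[of x] x\<Omega> K0[OF x(1)] lap by (simp add: xg lt flip: n_def)
  also have "\<dots> = k / n\<^sup>2 * (W2 - 2 * \<rho> * W1 + lam * (?W (s x) powr \<tau> * \<bar>W1\<bar> powr (1 - \<tau>)))"
    using n by (simp add: field_simps)
  also have "\<dots> \<le> k / n\<^sup>2 * (c * ?W (s x) powr q)"
    using super[OF sx] k unfolding W1_def W2_def by (intro mult_left_mono) auto
  also have "\<dots> < k powr q / n\<^sup>2 * (c * ?W (s x) powr q)"
    using k par c(2) W n powr_less_mono[of 1 q k]
    by (intro mult_strict_right_mono divide_strict_right_mono) auto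
  also have "\<dots> = c / n\<^sup>2 * u x powr q"
    using k W by (simp add: u_eq powr_mult)
  also have "\<dots> \<le> n powr (\<theta> + 2) / n\<^sup>2 * u x powr q"
    using c(1)[of x] x\<Omega> K0[OF x(1)] by (intro mult_right_mono divide_right_mono) (auto simp: n_def)
  also have "\<dots> = n powr \<theta> * u x powr q" using n by (simp add: powr_add)
  finally show False by simp
qed

section \<open>Nonexistence, by shrinking the blow-up sphere to the origin\<close>

theorem corollary9p3:
  fixes \<Omega> :: "(real^'n::finite) set"
    and q \<tau> \<rho> lam \<theta> :: real
  assumes "CARD('n) \<ge> 2"
    and "open \<Omega>" and "connected \<Omega>" and "bounded \<Omega>" and "0 \<in> \<Omega>"
    and "q > 1" and "0 \<le> \<tau>" and "\<tau> < 1" and "\<theta> \<le> -2"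
  shows "\<not> (\<exists>u :: real^'n \<Rightarrow> real.
      C2_on (\<Omega> - {0}) u \<and>
      continuous_on (closure \<Omega> - {0}) u \<and>
      (\<forall>x\<in>\<Omega> - {0}. u x > 0) \<and>
      (\<forall>x\<in>frontier \<Omega>. u x = 0) \<and>
      (\<forall>x\<in>\<Omega> - {0}.
         laplacian u x
         - (real CARD('n) - 2 + 2 * \<rho>) * (x \<bullet> gradient u x) / (norm x)\<^sup>2
         + lam * (u x powr \<tau> * norm (gradient u x) powr (1 - \<tau>)) / norm x powr (1 + \<tau>)
         = norm x powr \<theta> * u x powr q))"
proof (intro notI, elim exE conjE)
  fix u :: "real^'n \<Rightarrow> real"
  assume u: "C2_on (\<Omega> - {0}) u" "continuous_on (closure \<Omega> - {0}) u"
      "\<forall>x\<in>\<Omega> - {0}. u x > 0" "\<forall>x\<in>frontier \<Omega>. u x = 0"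
    and eq: "\<forall>x\<in>\<Omega> - {0}.
         laplacian u x
         - (real CARD('n) - 2 + 2 * \<rho>) * (x \<bullet> gradient u x) / (norm x)\<^sup>2
         + lam * (u x powr \<tau> * norm (gradient u x) powr (1 - \<tau>)) / norm x powr (1 + \<tau>)
         = norm x powr \<theta> * u x powr q"
  obtain R where R: "R > 0" "\<And>x. x \<in> \<Omega> \<Longrightarrow> norm x \<le> R"
    using \<open>bounded \<Omega>\<close> bounded_pos by metis
  \<comment> \<open>As \<theta> + 2 is not positive, r^(\<theta> + 2) does not increase with r, so
    its value at the outer radius \<open>R\<close> is a lower bound on the punctured domain.\<close>
  define c where "c = R powr (\<theta> + 2)"
  have c: "c > 0" "\<And>x. x \<in> \<Omega> - {0} \<Longrightarrow> c \<le> norm x powr (\<theta> + 2)"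
    using R assms by (auto simp: c_def intro!: powr_mono2')
  define a where "a = 2 / (q - 1)"
  define b where "b = (1 - \<tau>) / (q - 1)"
  \<comment> \<open>\<open>b < a\<close> because 1 - \<tau> is at most 1. Strictness matters for the
    continuity at t = 0 of \<open>t powr (a - b)\<close> in the reciprocal barrier, since
    \<open>0 powr 0 = 0\<close>.\<close>
  have ab: "0 < b" "b < a" "0 < a"
    using assms by (auto simp: a_def b_def divide_strict_right_mono)
  obtain A where A: "A > 0"
    "\<And>s. s > 0 \<Longrightarrow> barrier'' A a b s - 2 * \<rho> * barrier' A a b s
        + lam * (barrier A a b s powr \<tau> * \<bar>barrier' A a b s\<bar> powr (1 - \<tau>))
      \<le> c * barrier A a b s powr q"
    using barrier_supersolution[OF assms(6-8) c(1)] unfolding a_def b_def by blast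
  have "\<Omega> \<noteq> {0}" using \<open>open \<Omega>\<close> not_open_singleton by blast
  then obtain x where x: "x \<in> \<Omega> - {0}" using \<open>0 \<in> \<Omega>\<close> by blast
  \<comment> \<open>\<open>A\<close> was fixed before \<open>T\<close>, so at the fixed point
    \<open>x\<close> the barrier value tends to 0 and drops below \<open>u x > 0\<close>. A large
    \<open>T\<close> also puts \<open>x\<close> outside the ball of radius exp(-T), as the
    comparison requires.\<close>
  have "filterlim (\<lambda>T. ln (norm x) + T) at_top at_top"
    by (rule filterlim_tendsto_add_at_top[OF tendsto_const filterlim_ident])
  then have "((\<lambda>T. barrier A a b (ln (norm x) + T)) \<longlongrightarrow> 0) at_top"
    by (rule filterlim_compose[OF barrier_tendsto_0[OF ab(3,1)]])
  then have "\<forall>\<^sub>F T in at_top. barrier A a b (ln (norm x) + T) < u x \<and> - ln (norm x) < T"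
    using u(3) x by (intro eventually_conj order_tendstoD(2) eventually_gt_at_top) auto
  then obtain T where T: "barrier A a b (ln (norm x) + T) < u x" "- ln (norm x) < T"
    using eventually_happens by fastforce
  have "exp (- T) < exp (ln (norm x))" using T(2) by (subst exp_less_cancel_iff) simp
  then have "exp (- T) < norm x" using x by (subst (asm) exp_ln) auto
  then have "u x \<le> barrier A a b (ln (norm x) + T)"
    using u(4) eq x
    by (intro solution_le_barrier[OF assms(2,4,6-8) A(1) ab(1,2) c(2,1) A(2) u(1,2)]) auto
  with T show False by simp
qed

end
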